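(* Let $k=k_n$ be a sequence of positive integers with $k/\sqrt{n}\to\infty$ and $k/n\to 0$ as $n\to\infty$ (so $k\to\infty$). For each $n$ let $t=t_n$ be an integer with $0\le t\le \binom{n}{k}$, and let a family of $t$ distinct $k$-element subsets of a fixed $n$-element set be chosen uniformly at random among all such families. Let $X_0$ be the number of unordered pairs of disjoint sets in the chosen family, and put $$t_0=\sqrt{\frac{2\binom{n}{k}}{\binom{n-k}{k}}}.$$ Then, as $n\to\infty$: (i) if $t\ll t_0$, then $\mathbb{P}(X_0=0)\to 1$; (ii) if $t\gg t_0$, then $\mathbb{P}(X_0=0)\to 0$; (iii) if $t=(A+o(1))\,t_0$ for a constant $A>0$, then $\mathbb{P}(X_0=0)\to e^{-A^2}$. Moreover, if in addition $k=o(n^{2/3})$, then (i), (ii) and (iii) also hold with $t_0$ replaced by $\sqrt{2}\,e^{k^2/(2n)}$.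
   Context: For sequences of nonnegative reals, $a_n\ll b_n$ (equivalently $b_n\gg a_n$) means $a_n/b_n\to 0$ as $n\to\infty$. The event $X_0=0$ is the event that the chosen family has the "EKR property", i.e. any two of its sets have nonempty intersection. *)

theory Defs
  imports "HOL-Probability.Probability" "HOL-Library.Landau_Symbols"
begin

definition uniform_families :: "'a set \<Rightarrow> nat \<Rightarrow> nat \<Rightarrow> 'a set set set" where
  "uniform_families V k t = {F. F \<subseteq> {S. S \<subseteq> V \<and> card S = k} \<and> card F = t}"

definition random_family :: "'a set \<Rightarrow> nat \<Rightarrow> nat \<Rightarrow> 'a set set pmf" where
  "random_family V k t = pmf_of_set (uniform_families V k t)"

text \<open>The next two facts ensure that \<^const>\<open>pmf_of_set\<close> is applied
  to a finite nonempty set, so that it is the uniform distribution.\<close>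

lemma finite_uniform_families:
  assumes "finite V"
  shows "finite (uniform_families V k t)"
proof (rule finite_subset)
  show "uniform_families V k t \<subseteq> Pow (Pow V)"
    by (auto simp: uniform_families_def)
  show "finite (Pow (Pow V))"
    using assms by simp
qed

lemma uniform_families_nonempty:
  assumes "finite V" and "t \<le> card V choose k"
  shows "uniform_families V k t \<noteq> {}"
proof -
  have "t \<le> card {S. S \<subseteq> V \<and> card S = k}"
    using assms n_subsets[of V k] by simp
  then obtain F where "F \<subseteq> {S. S \<subseteq> V \<and> card S = k}" "card F = t"
    by (meson obtain_subset_with_card_n)
  then show ?thesis
    by (auto simp: uniform_families_def)
qed

text \<open>Unordered pairs are encoded as two-element sets.\<close>

definition num_disjoint_pairs :: "'a set set \<Rightarrow> nat" where
  "num_disjoint_pairs F = card {{S, T} | S T. S \<in> F \<and> T \<in> F \<and> S \<noteq> T \<and> S \<inter> T = {}}"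

definition t0 :: "nat \<Rightarrow> nat \<Rightarrow> real" where
  "t0 n k = sqrt (2 * real (n choose k) / real ((n - k) choose k))"

text \<open>Since \<open>x / 0 = 0\<close>, the ratio alone would make every sequence negligible with respect to
  the zero sequence; a convergent quotient presupposes that the denominator is eventually positive.\<close>

definition much_less :: "(nat \<Rightarrow> real) \<Rightarrow> (nat \<Rightarrow> real) \<Rightarrow> bool" where
  "much_less a b \<longleftrightarrow> (\<forall>\<^sub>F n in sequentially. b n > 0) \<and> (\<lambda>n. a n / b n) \<longlonglongrightarrow> 0"

text \<open>\<open>a = (c + o(1)) b\<close>. The equation is only required eventually, because for small \<open>n\<close>
  the quantity \<^const>\<open>t0\<close> may involve a division by zero.\<close>

definition asymp_multiple :: "(nat \<Rightarrow> real) \<Rightarrow> real \<Rightarrow> (nat \<Rightarrow> real) \<Rightarrow> bool" where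
  "asymp_multiple a c b \<longleftrightarrow>
     (\<exists>\<epsilon>. \<epsilon> \<longlonglongrightarrow> 0 \<and> (\<forall>\<^sub>F n in sequentially. a n = (c + \<epsilon> n) * b n))"

end

theory Submission
  imports Defs
begin

text \<open>
  The family has the EKR property exactly when it is an independent set of the Kneser graph, whose
  vertices are the \<open>N = binom(n, k)\<close> many \<open>k\<close>-sets and whose edges join disjoint sets. Each vertex
  has degree \<open>M = binom(n - k, k)\<close>. With \<open>p = M / N\<close> the threshold is \<open>t0 = sqrt (2 / p)\<close>, and
  \<open>p \<le> exp (- k^2 / n)\<close> tends to \<open>0\<close> because \<open>k / sqrt n\<close> tends to infinity. What the argument
  uses of the Kneser graph is that it is regular and that \<open>p\<close> is positive and tends to \<open>0\<close>.

  Let \<open>P j\<close> be the probability that a random \<open>j\<close>-set of vertices is independent. Choose the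
  vertices one at a time. The first \<open>j\<close> of them, if independent, exclude their joint neighbourhood, which has at
  most \<open>j * M\<close> vertices, and at least \<open>j * M\<close> minus the number of pairs with a common neighbour,
  counted with multiplicity. Averaged over all \<open>j\<close>-sets, the latter correction is at most
  \<open>j^2 * M^2 / (2 * N)\<close> by regularity. So \<open>P (j + 1)\<close> lies between
  \<open>P j * (1 - j * M / (N - j))\<close> and the same quantity plus \<open>j^2 * p^2\<close>
  (\<open>indep_prob_Suc_ge\<close>, \<open>indep_prob_Suc_le\<close>; the constant here is for \<open>j \<le> N / 2\<close>).
  Iterating \<open>t\<close> times gives \<open>P t = exp (- p * t^2 / 2)\<close> up to errors that are controlled by \<open>t * p\<close> and \<open>p * t^2\<close>
  (\<open>indep_prob_ge\<close>, \<open>indep_prob_le\<close>). If \<open>t / t0\<close> tends to \<open>A\<close>, then \<open>p * t^2 / 2\<close> tends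
  to \<open>A^2\<close> and \<open>t * p\<close> tends to \<open>0\<close>, so \<open>P t\<close> tends to \<open>exp (- A^2)\<close>; the case
  \<open>A = 0\<close> is (i), the case \<open>A > 0\<close> is (iii). Since \<open>P\<close> is decreasing, (ii) follows by letting
  \<open>A\<close> grow.

  For \<open>k = o(n^(2/3))\<close>, taking logarithms of the \<open>k\<close> factors of \<open>N / M\<close> gives
  \<open>N / M = exp (k^2 / n + O(k^3 / n^2))\<close>, so \<open>sqrt 2 * exp (k^2 / (2 * n))\<close> is asymptotic to
  \<open>t0\<close> and can replace it.
\<close>

section \<open>Pairs of points in subsets of a given size\<close>

text \<open>Multiplying out the denominator of \<open>binom(N - 2, j - 2) / binom(N, j) = j (j - 1) / (N (N - 1))\<close>
  lets the identity hold for every \<open>j\<close>, including the degenerate values \<open>j < 2\<close> and \<open>j > N\<close>.\<close>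
lemma card_supersets_of_pair:
  assumes "finite U" "P \<subseteq> U" "card P = 2"
  shows "card {F. P \<subseteq> F \<and> F \<subseteq> U \<and> card F = j} * (card U * (card U - 1)) =
           j * (j - 1) * (card U choose j)"
proof (cases "2 \<le> j \<and> j \<le> card U")
  case True
  have finP: "finite P" using assms finite_subset by blast
  have "card {F. P \<subseteq> F \<and> F \<subseteq> U \<and> card F = j} = card {G. G \<subseteq> U - P \<and> card G = j - 2}"
  proof (rule bij_betw_same_card[of "\<lambda>F. F - P"], rule bij_betw_byWitness[where f' = "\<lambda>G. G \<union> P"])
    show "(\<lambda>F. F - P) ` {F. P \<subseteq> F \<and> F \<subseteq> U \<and> card F = j} \<subseteq> {G. G \<subseteq> U - P \<and> card G = j - 2}"
      using finP assms by (auto simp: card_Diff_subset)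
    show "(\<lambda>G. G \<union> P) ` {G. G \<subseteq> U - P \<and> card G = j - 2} \<subseteq> {F. P \<subseteq> F \<and> F \<subseteq> U \<and> card F = j}"
    proof (intro subsetI, elim imageE, clarify)
      fix G assume G: "G \<subseteq> U - P" "card G = j - 2"
      have "finite G" using G assms finite_subset by blast
      then have "card (G \<union> P) = card G + card P"
        using G finP by (intro card_Un_disjoint) auto
      then show "P \<subseteq> G \<union> P \<and> G \<union> P \<subseteq> U \<and> card (G \<union> P) = j"
        using G assms True by auto
    qed
  qed auto
  also have "\<dots> = (card U - 2) choose (j - 2)"
    using n_subsets[of "U - P" "j - 2"] assms finP by (simp add: card_Diff_subset)
  finally have *: "card {F. P \<subseteq> F \<and> F \<subseteq> U \<and> card F = j} = (card U - 2) choose (j - 2)" .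
  obtain n where n: "card U = Suc (Suc n)"
    using True by (metis One_nat_def Suc_1 Suc_le_D le_trans not_less_eq_eq)
  obtain i where i: "j = Suc (Suc i)"
    using True by (metis One_nat_def Suc_1 Suc_le_D not_less_eq_eq)
  have "Suc (Suc i) * Suc i * (Suc (Suc n) choose Suc (Suc i)) =
          Suc i * (Suc (Suc i) * (Suc (Suc n) choose Suc (Suc i)))"
    by (simp only: ac_simps)
  also have "\<dots> = Suc i * (Suc (Suc n) * (Suc n choose Suc i))"
    by (simp only: Suc_times_binomial)
  also have "\<dots> = Suc (Suc n) * (Suc i * (Suc n choose Suc i))"
    by (rule mult.left_commute)
  also have "\<dots> = Suc (Suc n) * (Suc n * (n choose i))"
    by (simp only: Suc_times_binomial)
  finally show ?thesis
    unfolding * unfolding n i by (simp del: binomial_Suc_Suc mult_Suc mult_Suc_right add: ac_simps)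
next
  case False
  have none: "{F. P \<subseteq> F \<and> F \<subseteq> U \<and> card F = j} = {}"
  proof (rule ccontr)
    assume "{F. P \<subseteq> F \<and> F \<subseteq> U \<and> card F = j} \<noteq> {}"
    then obtain F where F: "P \<subseteq> F" "F \<subseteq> U" "card F = j" by blast
    then have "card P \<le> card F" "card F \<le> card U"
      using assms(1) finite_subset[of F U] by (auto intro!: card_mono)
    then show False using False F assms by simp
  qed
  have "j = 0 \<or> j = 1 \<or> card U < j"
    using False by linarith
  then have zero: "j * (j - 1) * (card U choose j) = 0"
    by (elim disjE) simp_all
  show ?thesis
    unfolding none zero by simp
qed

text \<open>The expected number of pairs of \<open>A\<close> inside a random \<open>j\<close>-set, by double counting: a fixed
  pair lies in a fraction \<open>j (j - 1) / (N (N - 1))\<close> of all \<open>j\<close>-sets.\<close>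
lemma sum_pairs_in_subset:
  assumes "finite U" "A \<subseteq> U"
  shows "(\<Sum>F\<in>{F. F \<subseteq> U \<and> card F = j}. card (A \<inter> F) choose 2) * (card U * (card U - 1)) =
           (card A choose 2) * (j * (j - 1) * (card U choose j))"
proof -
  have finA: "finite A" using assms finite_subset by blast
  let ?FF = "{F. F \<subseteq> U \<and> card F = j}" and ?PP = "{P. P \<subseteq> A \<and> card P = 2}"
  have finF: "finite ?FF"
    by (rule finite_subset[of _ "Pow U"]) (use assms in auto)
  have finP: "finite ?PP"
    by (rule finite_subset[of _ "Pow A"]) (use finA in auto)
  have "(\<Sum>F\<in>?FF. card (A \<inter> F) choose 2) = (\<Sum>F\<in>?FF. \<Sum>P\<in>{P \<in> ?PP. P \<subseteq> F}. 1)"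
  proof (rule sum.cong)
    fix F
    have "card (A \<inter> F) choose 2 = card {P. P \<subseteq> A \<inter> F \<and> card P = 2}"
      using n_subsets[of "A \<inter> F" 2] finA by simp
    also have "{P. P \<subseteq> A \<inter> F \<and> card P = 2} = {P \<in> ?PP. P \<subseteq> F}" by auto
    finally show "card (A \<inter> F) choose 2 = (\<Sum>P\<in>{P \<in> ?PP. P \<subseteq> F}. 1)" by simp
  qed simp
  also have "\<dots> = (\<Sum>P\<in>?PP. \<Sum>F\<in>{F \<in> ?FF. P \<subseteq> F}. 1)"
    by (rule sum.swap_restrict[OF finF finP])
  also have "\<dots> = (\<Sum>P\<in>?PP. card {F. P \<subseteq> F \<and> F \<subseteq> U \<and> card F = j})"
    by (rule sum.cong) (auto intro!: arg_cong[where f = card])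
  finally have "(\<Sum>F\<in>?FF. card (A \<inter> F) choose 2) * (card U * (card U - 1)) =
      (\<Sum>P\<in>?PP. card {F. P \<subseteq> F \<and> F \<subseteq> U \<and> card F = j} * (card U * (card U - 1)))"
    by (simp only: sum_distrib_right)
  also have "\<dots> = (\<Sum>P\<in>?PP. j * (j - 1) * (card U choose j))"
  proof (rule sum.cong)
    fix P assume "P \<in> ?PP"
    then show "card {F. P \<subseteq> F \<and> F \<subseteq> U \<and> card F = j} * (card U * (card U - 1)) =
        j * (j - 1) * (card U choose j)"
      using assms by (intro card_supersets_of_pair) auto
  qed simp
  also have "\<dots> = (card A choose 2) * (j * (j - 1) * (card U choose j))"
    using n_subsets[OF finA, of 2] by simp
  finally show ?thesis .
qed

lemma Suc_times_choose_Suc: "Suc j * (n choose Suc j) = (n - j) * (n choose j)"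
proof (cases n)
  case (Suc m)
  then show ?thesis
    by (simp only: Suc_times_binomial binomial_absorb_comp) simp
qed simp

section \<open>Independent sets in a regular graph\<close>

locale regular_graph =
  fixes U :: "'v set" and nb :: "'v \<Rightarrow> 'v set" and M :: nat
  assumes fin: "finite U"
    and nb_subset: "v \<in> U \<Longrightarrow> nb v \<subseteq> U"
    and card_nb: "v \<in> U \<Longrightarrow> card (nb v) = M"
    and nb_sym: "v \<in> U \<Longrightarrow> w \<in> nb v \<Longrightarrow> v \<in> nb w"
    and nb_irrefl: "v \<in> U \<Longrightarrow> v \<notin> nb v"
begin

abbreviation N :: nat where "N \<equiv> card U"

definition indep_sets :: "nat \<Rightarrow> 'v set set" where
  "indep_sets j = {F. F \<subseteq> U \<and> card F = j \<and> (\<forall>v\<in>F. nb v \<inter> F = {})}"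

text \<open>The probability that a uniformly random \<open>j\<close>-set of vertices spans no edge; it is \<open>0\<close>
  by division by zero when \<open>j > N\<close>, which keeps it decreasing in \<open>j\<close> without a bound on \<open>j\<close>.\<close>
definition indep_prob :: "nat \<Rightarrow> real" where
  "indep_prob j = real (card (indep_sets j)) / real (N choose j)"

definition neighbourhood :: "'v set \<Rightarrow> 'v set" where
  "neighbourhood F = \<Union> (nb ` F)"

lemma finite_indep_sets: "finite (indep_sets j)"
  by (rule finite_subset[of _ "Pow U"]) (auto simp: indep_sets_def fin)

lemma neighbourhood_subset: "F \<subseteq> U \<Longrightarrow> neighbourhood F \<subseteq> U"
  unfolding neighbourhood_def using nb_subset by blast

lemma indep_setsD:
  assumes "F \<in> indep_sets j"
  shows "F \<subseteq> U" "card F = j" "F \<inter> neighbourhood F = {}" "finite F"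
  using assms fin finite_subset unfolding indep_sets_def neighbourhood_def by blast+

lemma insert_indep:
  assumes F: "F \<in> indep_sets j" and v: "v \<in> U - F - neighbourhood F"
  shows "insert v F \<in> indep_sets (Suc j)"
proof -
  have "nb v \<inter> F = {}"
    using v nb_sym unfolding neighbourhood_def by blast
  then show ?thesis
    using F v nb_irrefl indep_setsD[OF F]
    by (auto simp: indep_sets_def neighbourhood_def)
qed

lemma remove_indep:
  assumes G: "G \<in> indep_sets (Suc j)" and v: "v \<in> G"
  shows "G - {v} \<in> indep_sets j" "v \<in> U - (G - {v}) - neighbourhood (G - {v})"
  using assms indep_setsD[OF G] by (auto simp: indep_sets_def neighbourhood_def)

text \<open>Both sides count pairs of an independent \<open>(j + 1)\<close>-set and one distinguished vertex of it:
  removing the vertex leaves an independent \<open>j\<close>-set, and the vertex lies outside that set and its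
  neighbourhood. This identity drives the whole argument.\<close>
lemma indep_sets_Suc:
  "Suc j * card (indep_sets (Suc j)) =
     (\<Sum>F\<in>indep_sets j. card (U - F - neighbourhood F))"
proof -
  have "Suc j * card (indep_sets (Suc j)) = (\<Sum>G\<in>indep_sets (Suc j). card G)"
    by (simp add: indep_setsD(2))
  also have "\<dots> = card (SIGMA G:indep_sets (Suc j). G)"
    by (rule card_SigmaI[symmetric]) (auto simp: finite_indep_sets indep_setsD(4))
  also have "\<dots> = card (SIGMA F:indep_sets j. U - F - neighbourhood F)"
    by (rule bij_betw_same_card[of "\<lambda>(G, v). (G - {v}, v)"],
        rule bij_betw_byWitness[where f' = "\<lambda>(F, v). (insert v F, v)"])
       (use insert_indep remove_indep in auto)
  also have "\<dots> = (\<Sum>F\<in>indep_sets j. card (U - F - neighbourhood F))"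
    by (rule card_SigmaI) (auto simp: finite_indep_sets fin)
  finally show ?thesis .
qed

lemma card_neighbourhood_le:
  assumes "F \<subseteq> U"
  shows "card (neighbourhood F) \<le> card F * M"
proof -
  have "card (neighbourhood F) \<le> (\<Sum>v\<in>F. card (nb v))"
    unfolding neighbourhood_def by (rule card_UN_le) (use assms fin finite_subset in blast)
  then show ?thesis
    using assms card_nb by (simp add: subset_eq)
qed

text \<open>A vertex \<open>w\<close> is counted \<open>card (nb w \<inter> F)\<close> times in the sum \<open>card F * M\<close> of the degrees over \<open>F\<close>,
  and \<open>m \<le> [m > 0] + binom(m, 2)\<close>. So the neighbourhood falls short of \<open>card F * M\<close> by at most the
  number of pairs in \<open>F\<close> with a common neighbour, counted once for each such neighbour.\<close>
lemma card_neighbourhood_ge: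
  assumes F: "F \<subseteq> U"
  shows "card F * M \<le> card (neighbourhood F) + (\<Sum>w\<in>U. card (nb w \<inter> F) choose 2)"
proof -
  have finF: "finite F"
    using F fin finite_subset by blast
  have swap: "{v \<in> F. w \<in> nb v} = nb w \<inter> F" if "w \<in> U" for w
    using that F nb_sym nb_subset by blast
  have hit: "w \<in> neighbourhood F" if "w \<in> U" "nb w \<inter> F \<noteq> {}" for w
    using that F nb_sym unfolding neighbourhood_def by blast
  have bonf: "m \<le> (if m = 0 then 0 else 1) + (m choose 2)" for m :: nat
    by (induction m) (auto simp: numeral_2_eq_2)
  have "card F * M = (\<Sum>v\<in>F. card (nb v))"
    using F card_nb by (simp add: subset_eq)
  also have "\<dots> = (\<Sum>v\<in>F. \<Sum>w\<in>{w \<in> U. w \<in> nb v}. 1)"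
  proof (rule sum.cong)
    fix v assume "v \<in> F"
    then have "{w \<in> U. w \<in> nb v} = nb v" using F nb_subset by blast
    then show "card (nb v) = (\<Sum>w\<in>{w \<in> U. w \<in> nb v}. 1)" by simp
  qed simp
  also have "\<dots> = (\<Sum>w\<in>U. \<Sum>v\<in>{v \<in> F. w \<in> nb v}. 1)"
    by (rule sum.swap_restrict) (auto simp: finF fin)
  also have "\<dots> = (\<Sum>w\<in>U. card (nb w \<inter> F))"
    by (rule sum.cong) (auto simp: swap)
  also have "\<dots> \<le> (\<Sum>w\<in>U. (if w \<in> neighbourhood F then 1 else 0) + (card (nb w \<inter> F) choose 2))"
  proof (rule sum_mono)
    fix w assume "w \<in> U"
    then show "card (nb w \<inter> F) \<le> (if w \<in> neighbourhood F then 1 else 0) + (card (nb w \<inter> F) choose 2)"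
      using bonf[of "card (nb w \<inter> F)"] hit[of w] by (cases "nb w \<inter> F = {}") (auto split: if_splits)
  qed
  also have "\<dots> = card (neighbourhood F) + (\<Sum>w\<in>U. card (nb w \<inter> F) choose 2)"
    using neighbourhood_subset[OF F] fin
    by (simp add: sum.distrib sum.If_cases Int_absorb1)
  finally show ?thesis .
qed

lemma card_non_neighbours:
  assumes "F \<in> indep_sets j"
  shows "real (card (U - F - neighbourhood F)) = real N - real j - real (card (neighbourhood F))"
proof -
  note F = indep_setsD[OF assms]
  have sub: "neighbourhood F \<subseteq> U - F"
    using neighbourhood_subset[OF F(1)] F(3) by blast
  have "card (U - F - neighbourhood F) = (N - j) - card (neighbourhood F)"
    using sub F fin by (simp add: card_Diff_subset finite_subset)
  moreover have "card (neighbourhood F) \<le> N - j" "j \<le> N"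
    using card_mono[OF _ sub] F fin card_mono[OF fin F(1)] by (auto simp: card_Diff_subset)
  ultimately show ?thesis by simp
qed

lemma indep_prob_nonneg: "0 \<le> indep_prob j"
  by (simp add: indep_prob_def)

lemma indep_sets_0: "indep_sets 0 = {{}}"
  using fin by (auto simp: indep_sets_def finite_subset)

lemma indep_prob_0: "indep_prob 0 = 1"
  by (simp add: indep_prob_def indep_sets_0)

text \<open>The summand divided by \<open>N - j\<close> is the probability that a random new vertex extends \<open>F\<close> to a
  larger independent set.\<close>
lemma indep_prob_Suc:
  assumes "j < N"
  shows "indep_prob (Suc j) =
    (\<Sum>F\<in>indep_sets j. real N - real j - real (card (neighbourhood F))) / ((real N - real j) * real (N choose j))"
proof -
  have "real (Suc j) * real (card (indep_sets (Suc j))) =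
      (\<Sum>F\<in>indep_sets j. real (card (U - F - neighbourhood F)))"
    using indep_sets_Suc[of j] by (simp only: of_nat_sum [symmetric] of_nat_mult [symmetric])
  also have "\<dots> = (\<Sum>F\<in>indep_sets j. real N - real j - real (card (neighbourhood F)))"
    by (rule sum.cong) (auto simp: card_non_neighbours)
  finally have a: "real (Suc j) * real (card (indep_sets (Suc j))) = \<dots>" .
  have b: "real (Suc j) * real (N choose Suc j) = (real N - real j) * real (N choose j)"
    using Suc_times_choose_Suc[of j N] assms
    by (simp only: of_nat_mult [symmetric] of_nat_diff [symmetric] less_imp_le)
  show ?thesis
    unfolding a[symmetric] b[symmetric] indep_prob_def by simp
qed

lemma indep_prob_Suc_ge:
  assumes "j < N"
  shows "indep_prob j * (1 - real j * real M / (real N - real j)) \<le> indep_prob (Suc j)"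
proof -
  have pos: "(real N - real j) * real (N choose j) > 0"
    using assms by simp
  have "real (card (indep_sets j)) * (real N - real j - real j * real M) =
      (\<Sum>F\<in>indep_sets j. real N - real j - real j * real M)"
    by simp
  also have "\<dots> \<le> (\<Sum>F\<in>indep_sets j. real N - real j - real (card (neighbourhood F)))"
  proof (rule sum_mono)
    fix F assume "F \<in> indep_sets j"
    then have "card (neighbourhood F) \<le> j * M"
      using card_neighbourhood_le[of F] indep_setsD by metis
    then have "real (card (neighbourhood F)) \<le> real j * real M"
      by (simp only: of_nat_mult [symmetric] of_nat_le_iff)
    then show "real N - real j - real j * real M \<le> real N - real j - real (card (neighbourhood F))"
      by simp
  qed
  finally have "real (card (indep_sets j)) * (real N - real j - real j * real M) / ((real N - real j) * real (N choose j))
      \<le> indep_prob (Suc j)"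
    unfolding indep_prob_Suc[OF assms] using pos by (intro divide_right_mono) auto
  also have "real (card (indep_sets j)) * (real N - real j - real j * real M) / ((real N - real j) * real (N choose j))
      = indep_prob j * (1 - real j * real M / (real N - real j))"
    unfolding indep_prob_def using assms by (simp add: field_simps)
  finally show ?thesis .
qed

lemma indep_prob_antimono:
  assumes "i \<le> j"
  shows "indep_prob j \<le> indep_prob i"
proof (rule lift_Suc_antimono_le[OF _ assms])
  fix j
  show "indep_prob (Suc j) \<le> indep_prob j"
  proof (cases "j < N")
    case True
    have "(\<Sum>F\<in>indep_sets j. real N - real j - real (card (neighbourhood F))) \<le>
        (\<Sum>F\<in>indep_sets j. real N - real j)"
      by (rule sum_mono) simp
    then have "indep_prob (Suc j) \<le> real (card (indep_sets j)) * (real N - real j) / ((real N - real j) * real (N choose j))"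
      unfolding indep_prob_Suc[OF True] using True by (intro divide_right_mono) auto
    also have "\<dots> = indep_prob j"
      unfolding indep_prob_def using True by simp
    finally show ?thesis .
  next
    case False
    then show ?thesis by (simp add: indep_prob_def binomial_eq_0)
  qed
qed

lemma M_le_N: "U \<noteq> {} \<Longrightarrow> M \<le> N"
  using card_nb nb_subset fin card_mono by (metis ex_in_conv)

text \<open>Passing from independent \<open>j\<close>-sets to all \<open>j\<close>-sets only increases the sum, and over all \<open>j\<close>-sets
  regularity gives its exact value, since the pairs with common neighbour \<open>w\<close> are the pairs inside
  \<open>nb w\<close>.\<close>
lemma sum_common_neighbours_le:
  assumes "j < N"
  shows "(\<Sum>F\<in>indep_sets j. \<Sum>w\<in>U. real (card (nb w \<inter> F) choose 2)) * real N
           \<le> (real j)\<^sup>2 * (real M)\<^sup>2 / 2 * real (N choose j)"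
proof (cases "j = 0")
  case True
  then show ?thesis by (simp add: indep_sets_0 binomial_eq_0)
next
  case False
  define S where "S = (\<Sum>F\<in>indep_sets j. \<Sum>w\<in>U. card (nb w \<inter> F) choose 2)"
  let ?FF = "{F. F \<subseteq> U \<and> card F = j}"
  have N2: "N \<ge> 2" using False assms by linarith
  have "M \<le> N" using M_le_N N2 by force
  \<comment> \<open>that is, \<open>(M - 1) / (N - 1) \<le> M / N\<close>\<close>
  then have le_M: "real N * (real M - 1) \<le> real M * (real N - 1)"
    by (simp add: algebra_simps)
  have le_j: "real j * (real j - 1) * real (N choose j) \<le> real j * real j * real (N choose j)"
    by (intro mult_right_mono mult_left_mono) auto
  have le_j0: "0 \<le> real j * (real j - 1) * real (N choose j)"
    using False by simp
  have "S \<le> (\<Sum>F\<in>?FF. \<Sum>w\<in>U. card (nb w \<inter> F) choose 2)"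
    unfolding S_def
  proof (rule sum_mono2)
    show "finite ?FF" by (rule finite_subset[of _ "Pow U"]) (use fin in auto)
  qed (auto simp: indep_sets_def)
  also have "\<dots> = (\<Sum>w\<in>U. \<Sum>F\<in>?FF. card (nb w \<inter> F) choose 2)"
    by (rule sum.swap)
  finally have "S * (N * (N - 1)) \<le> (\<Sum>w\<in>U. (\<Sum>F\<in>?FF. card (nb w \<inter> F) choose 2) * (N * (N - 1)))"
    by (simp only: sum_distrib_right [symmetric] mult_le_mono1)
  also have "\<dots> = (\<Sum>w\<in>U. (M choose 2) * (j * (j - 1) * (N choose j)))"
  proof (rule sum.cong)
    fix w assume w: "w \<in> U"
    show "(\<Sum>F\<in>?FF. card (nb w \<inter> F) choose 2) * (N * (N - 1)) = (M choose 2) * (j * (j - 1) * (N choose j))"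
      using sum_pairs_in_subset[OF fin nb_subset[OF w], of j] card_nb[OF w] by simp
  qed simp
  also have "\<dots> = N * ((M choose 2) * (j * (j - 1) * (N choose j)))"
    by simp
  finally have "S * (N - 1) \<le> (M choose 2) * (j * (j - 1) * (N choose j))"
    using N2 by (simp add: mult.left_commute[of S])
  then have "real S * (real N - 1) \<le> real (M choose 2) * (real j * (real j - 1) * real (N choose j))"
    using of_nat_diff[of 1 N, where 'a = real] of_nat_diff[of 1 j, where 'a = real] N2 False
    unfolding of_nat_le_iff [symmetric, where 'a = real] of_nat_mult by simp
  also have "real (M choose 2) = real M * (real M - 1) / 2"
    by (cases M) (simp_all add: choose_two real_of_nat_div algebra_simps)
  finally have "real N * (real S * (real N - 1)) \<le>
      real N * (real M * (real M - 1) / 2 * (real j * (real j - 1) * real (N choose j)))"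
    by (rule mult_left_mono) simp
  also have "\<dots> = (real N * (real M - 1)) * (real M / 2 * (real j * (real j - 1) * real (N choose j)))"
    by (simp add: algebra_simps)
  also have "\<dots> \<le> (real M * (real N - 1)) * (real M / 2 * (real j * real j * real (N choose j)))"
    by (rule mult_mono[OF le_M mult_left_mono[OF le_j]]) (use le_j0 N2 in auto)
  finally have "real S * real N * (real N - 1) \<le>
      ((real j)\<^sup>2 * (real M)\<^sup>2 / 2 * real (N choose j)) * (real N - 1)"
    by (simp add: power2_eq_square algebra_simps)
  then have "real S * real N \<le> (real j)\<^sup>2 * (real M)\<^sup>2 / 2 * real (N choose j)"
    using N2 by (subst (asm) mult_le_cancel_right_pos) auto
  then show ?thesis by (simp add: S_def)
qed

lemma indep_prob_Suc_le:
  assumes "j < N"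
  shows "indep_prob (Suc j) \<le> indep_prob j * (1 - real j * real M / (real N - real j))
           + (real j)\<^sup>2 * (real M)\<^sup>2 / (2 * real N * (real N - real j))"
proof -
  define S where "S = (\<Sum>F\<in>indep_sets j. \<Sum>w\<in>U. real (card (nb w \<inter> F) choose 2))"
  have pos: "(real N - real j) * real (N choose j) > 0" "real N > 0"
    "real N - real j > 0" "real (N choose j) > 0"
    using assms by auto
  have split: "(K * (D - a) + e / 2 * C / n) / (D * C) = K / C * (1 - a / D) + e / (2 * n * D)"
    if "D > 0" "C > 0" "n > 0" for K D C a e n :: real
    using that by (simp add: field_simps)
  have S: "S \<le> (real j)\<^sup>2 * (real M)\<^sup>2 / 2 * real (N choose j) / real N"
    using sum_common_neighbours_le[OF assms] pos(2) by (simp add: S_def pos_le_divide_eq)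
  have "(\<Sum>F\<in>indep_sets j. real N - real j - real (card (neighbourhood F))) \<le>
      (\<Sum>F\<in>indep_sets j. (real N - real j - real j * real M) + (\<Sum>w\<in>U. real (card (nb w \<inter> F) choose 2)))"
  proof (rule sum_mono)
    fix F assume F: "F \<in> indep_sets j"
    have "real (j * M) \<le> real (card (neighbourhood F) + (\<Sum>w\<in>U. card (nb w \<inter> F) choose 2))"
      using card_neighbourhood_ge[of F] indep_setsD[OF F] by (simp only: of_nat_le_iff)
    then show "real N - real j - real (card (neighbourhood F)) \<le>
      (real N - real j - real j * real M) + (\<Sum>w\<in>U. real (card (nb w \<inter> F) choose 2))"
      by simp
  qed
  also have "\<dots> = real (card (indep_sets j)) * (real N - real j - real j * real M) + S"
    by (simp add: sum.distrib S_def)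
  finally have "indep_prob (Suc j) \<le>
     (real (card (indep_sets j)) * (real N - real j - real j * real M) +
       (real j)\<^sup>2 * (real M)\<^sup>2 / 2 * real (N choose j) / real N) / ((real N - real j) * real (N choose j))"
    unfolding indep_prob_Suc[OF assms] using pos S by (intro divide_right_mono) auto
  also have "\<dots> = indep_prob j * (1 - real j * real M / (real N - real j))
           + (real j)\<^sup>2 * (real M)\<^sup>2 / (2 * real N * (real N - real j))"
    unfolding indep_prob_def by (rule split[OF pos(3,4,2)])
  finally show ?thesis .
qed

section \<open>Iterating the one-vertex estimates\<close>

definition density :: real where
  "density = real M / real N"

text \<open>A fixed vertex has about \<open>t * density\<close> neighbours in a random \<open>t\<close>-set. As long as this number
  is small, the \<open>t\<close> one-vertex estimates multiply up to \<open>exp (- density * t^2 / 2)\<close> with controlled error.\<close>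
context
  fixes t :: nat
  assumes ne: "U \<noteq> {}" and M: "M > 0" and small: "real t * density \<le> 1 / 4"
begin

lemma small_sample_bounds: "real N > 0" "0 < density" "real t / real N \<le> real t * density"
  "real t \<le> real N / 4"
proof -
  show N: "real N > 0" using ne fin by (simp add: card_gt_0_iff)
  then show "0 < density" using M by (simp add: density_def)
  have "real t * 1 \<le> real t * real M"
    using M by (intro mult_left_mono) auto
  then show *: "real t / real N \<le> real t * density"
    using N by (simp add: density_def divide_right_mono)
  have "real t / real N \<le> 1 / 4"
    using * small by (rule order_trans)
  then show "real t \<le> real N / 4"
    using N by (simp add: pos_divide_le_eq)
qed

text \<open>The fraction \<open>x\<close> bounds the probability that the next vertex hits the neighbourhood of \<open>j\<close> given
  ones. It differs from \<open>j * density\<close> by a factor \<open>N / (N - j)\<close>, and \<open>1 - x\<close> from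
  \<open>exp (- x)\<close> by a second-order term; both losses are absorbed in the factor \<open>1 + 6 * t * density\<close>.\<close>
lemma excluded_fraction_bounds:
  assumes "j < t"
  defines "x \<equiv> real j * real M / (real N - real j)"
  shows "real j * density \<le> x"
    and "x \<le> 1"
    and "exp (- (real j * density * (1 + 6 * (real t * density)))) \<le> 1 - x"
proof -
  note N = small_sample_bounds
  define y where "y = real j * density"
  define d where "d = real t * density"
  have yd: "0 \<le> y" "y \<le> d" "d \<le> 1 / 4"
    using N small assms by (auto simp: y_def d_def)
  have Nj: "real N - real j \<ge> 3 / 4 * real N"
    using N assms by simp
  have x: "x = y * (real N / (real N - real j))"
    using N by (simp add: x_def y_def density_def)
  have "real j / (real N - real j) \<le> real t / (3 / 4 * real N)"
    using Nj N assms by (intro frac_le) auto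
  also have "\<dots> \<le> 4 / 3 * d"
    using N(3) by (simp add: d_def)
  finally have j: "real j / (real N - real j) \<le> 4 / 3 * d" .
  have ratio: "real N / (real N - real j) = 1 + real j / (real N - real j)"
    using Nj N by (simp add: field_simps)
  show "real j * density \<le> x"
    unfolding x ratio y_def[symmetric] using yd Nj N by (simp add: algebra_simps)
  have xu: "x \<le> y * (1 + 4 / 3 * d)"
    unfolding x ratio using j yd by (intro mult_left_mono) auto
  also have "\<dots> \<le> y * (4 / 3)"
    using yd by (intro mult_left_mono) auto
  finally have x2: "x \<le> 4 / 3 * y" by simp
  have "0 \<le> x"
    using Nj N by (simp add: x_def)
  moreover have "x \<le> 1 / 2"
    using x2 yd by linarith
  ultimately have x0: "0 \<le> x" "x \<le> 1 / 2" .
  then show "x \<le> 1" by simp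
  have "x\<^sup>2 \<le> (4 / 3 * y)\<^sup>2"
    using x0 x2 by (intro power_mono) auto
  also have "\<dots> = 16 / 9 * (y * y)"
    by (simp add: power2_eq_square)
  also have "\<dots> \<le> 16 / 9 * (y * d)"
    using yd by (intro mult_left_mono) auto
  finally have "x + 2 * x\<^sup>2 \<le> y * (1 + 4 / 3 * d) + 32 / 9 * (y * d)"
    using xu by simp
  also have "\<dots> \<le> y * (1 + 6 * d)"
    using yd by (simp add: algebra_simps)
  finally have "- (y * (1 + 6 * d)) \<le> ln (1 - x)"
    using ln_one_minus_pos_lower_bound[OF x0] by simp
  then have "exp (- (y * (1 + 6 * d))) \<le> 1 - x"
    using x0 by (simp add: ln_ge_iff)
  then show "exp (- (real j * density * (1 + 6 * (real t * density)))) \<le> 1 - x"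
    by (simp add: y_def d_def)
qed

text \<open>The product of the lower bounds \<open>1 - x\<close>, with \<open>0 + 1 + \<dots> + (t - 1) \<le> t^2 / 2\<close>.\<close>
lemma indep_prob_ge:
  "exp (- (density * (real t)\<^sup>2 / 2) * (1 + 6 * (real t * density))) \<le> indep_prob t"
proof -
  define q where "q = density * (1 + 6 * (real t * density))"
  have q: "0 \<le> q" using small_sample_bounds by (simp add: q_def)
  have "exp (- (q * (real j * (real j - 1) / 2))) \<le> indep_prob j" if "j \<le> t" for j
    using that
  proof (induction j)
    case 0
    then show ?case by (simp add: indep_prob_0)
  next
    case (Suc j)
    then have j: "j < t" "j < N" using small_sample_bounds by auto
    have "exp (- (q * (real (Suc j) * (real (Suc j) - 1) / 2))) =
        exp (- (q * (real j * (real j - 1) / 2))) * exp (- (real j * q))"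
      unfolding exp_add [symmetric] by (rule arg_cong[where f = exp]) (simp add: field_simps)
    also have "\<dots> \<le> indep_prob j * (1 - real j * real M / (real N - real j))"
      using Suc j excluded_fraction_bounds(3)[OF j(1)]
      by (intro mult_mono) (auto simp: indep_prob_nonneg q_def mult.assoc)
    also have "\<dots> \<le> indep_prob (Suc j)"
      by (rule indep_prob_Suc_ge[OF j(2)])
    finally show ?case .
  qed
  from this[of t] have *: "exp (- (q * (real t * (real t - 1) / 2))) \<le> indep_prob t" by simp
  have "- (density * (real t)\<^sup>2 / 2) * (1 + 6 * (real t * density)) = - (q * ((real t)\<^sup>2 / 2))"
    by (simp add: q_def)
  also have "\<dots> \<le> - (q * (real t * (real t - 1) / 2))"
    using q by (simp add: power2_eq_square mult_left_mono)
  finally show ?thesis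
    using * by (meson exp_le_cancel_iff order_trans)
qed

text \<open>Each step multiplies by at most \<open>exp (- j * density)\<close> and adds at most \<open>j^2 * density^2\<close>, the
  cost of common neighbours. The added errors sum to at most \<open>t^3 * density^2\<close>, and
  \<open>0 + 1 + \<dots> + (t - 1) = t^2 / 2 - t / 2\<close> explains the term \<open>t * density / 2\<close>.\<close>
lemma indep_prob_le:
  "indep_prob t \<le> exp (- (density * (real t)\<^sup>2 / 2) + real t * density / 2)
     + density * (real t)\<^sup>2 * (real t * density)"
proof -
  let ?p = density
  have "indep_prob j \<le> exp (- (?p * (real j * (real j - 1) / 2))) + real j ^ 3 * ?p\<^sup>2"
    if "j \<le> t" for j
    using that
  proof (induction j)
    case 0
    then show ?case by (simp add: indep_prob_0)
  next
    case (Suc j)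
    then have j: "j < t" "j < N" using small_sample_bounds by auto
    let ?x = "real j * real M / (real N - real j)"
    have "1 - ?x \<le> 1 - real j * ?p"
      using excluded_fraction_bounds(1)[OF j(1)] by simp
    also have "\<dots> \<le> exp (- (real j * ?p))"
      using exp_ge_add_one_self[of "- (real j * ?p)"] by simp
    finally have "1 - ?x \<le> exp (- (real j * ?p))" .
    moreover have "0 \<le> 1 - ?x"
      using excluded_fraction_bounds(2)[OF j(1)] by simp
    ultimately have "indep_prob j * (1 - ?x) \<le>
        (exp (- (?p * (real j * (real j - 1) / 2))) + real j ^ 3 * ?p\<^sup>2) * exp (- (real j * ?p))"
      using Suc by (intro mult_mono) auto
    also have "\<dots> = exp (- (?p * (real (Suc j) * (real (Suc j) - 1) / 2)))
        + real j ^ 3 * ?p\<^sup>2 * exp (- (real j * ?p))"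
      unfolding distrib_right exp_add [symmetric]
      by (rule arg_cong[where f = "\<lambda>e. exp e + _"]) (simp add: field_simps)
    also have "real j ^ 3 * ?p\<^sup>2 * exp (- (real j * ?p)) \<le> real j ^ 3 * ?p\<^sup>2 * 1"
      using small_sample_bounds by (intro mult_left_mono) auto
    finally have main: "indep_prob j * (1 - ?x) \<le>
        exp (- (?p * (real (Suc j) * (real (Suc j) - 1) / 2))) + real j ^ 3 * ?p\<^sup>2" by simp
    have "real N * real N \<le> 2 * real N * (real N - real j)"
      using small_sample_bounds j by (simp add: mult_left_mono)
    then have "(real j)\<^sup>2 * (real M)\<^sup>2 / (2 * real N * (real N - real j)) \<le>
        (real j)\<^sup>2 * (real M)\<^sup>2 / (real N * real N)"
      using small_sample_bounds j by (intro divide_left_mono) auto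
    also have "\<dots> = (real j)\<^sup>2 * ?p\<^sup>2"
      by (simp add: density_def power2_eq_square)
    finally have "indep_prob (Suc j) \<le> exp (- (?p * (real (Suc j) * (real (Suc j) - 1) / 2)))
        + (real j ^ 3 + (real j)\<^sup>2) * ?p\<^sup>2"
      using indep_prob_Suc_le[OF j(2)] main by (simp only: distrib_right)
    also have "(real j ^ 3 + (real j)\<^sup>2) * ?p\<^sup>2 \<le> real (Suc j) ^ 3 * ?p\<^sup>2"
      by (intro mult_right_mono) (auto simp: power2_eq_square power3_eq_cube algebra_simps)
    finally show ?case by simp
  qed
  from this[of t] show ?thesis
    by (simp add: power2_eq_square power3_eq_cube algebra_simps diff_divide_distrib)
qed

end

end

section \<open>The threshold in sparse regular graphs\<close>

locale sparse_regular_graphs =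
  fixes U :: "nat \<Rightarrow> 'v set" and nb :: "nat \<Rightarrow> 'v \<Rightarrow> 'v set" and M :: "nat \<Rightarrow> nat"
  assumes regular: "\<And>n. regular_graph (U n) (nb n) (M n)"
    and M_pos: "\<forall>\<^sub>F n in sequentially. M n > 0"
    and U_nonempty: "\<forall>\<^sub>F n in sequentially. U n \<noteq> {}"
    and sparse: "(\<lambda>n. real (M n) / real (card (U n))) \<longlonglongrightarrow> 0"
begin

definition p :: "nat \<Rightarrow> real" where "p n = real (M n) / real (card (U n))"

abbreviation P :: "nat \<Rightarrow> nat \<Rightarrow> real" where
  "P n t \<equiv> regular_graph.indep_prob (U n) (nb n) t"

lemma p_nonneg: "0 \<le> p n"
  by (simp add: p_def)

lemma density_eq_p: "regular_graph.density (U n) (M n) = p n"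
  using regular_graph.density_def[OF regular] by (simp add: p_def)

lemma p_pos: "\<forall>\<^sub>F n in sequentially. p n > 0"
  using M_pos U_nonempty
proof eventually_elim
  case (elim n)
  then show ?case
    using regular_graph.fin[OF regular[of n]] by (simp add: p_def card_gt_0_iff)
qed

lemma sqrt_p_tendsto: "(\<lambda>n. sqrt (c * p n)) \<longlonglongrightarrow> 0"
  using tendsto_real_sqrt[OF tendsto_mult_right_zero[OF sparse, of c]] by (simp add: p_def)

text \<open>Write \<open>u = t * sqrt (p / 2)\<close>. Then \<open>p * t^2 / 2 = u^2\<close> and \<open>t * p = u * sqrt (2 * p)\<close>, so when \<open>u\<close>
  converges all error terms of the finite bounds vanish with \<open>p\<close>. The value \<open>A = 0\<close> covers the
  regime below the threshold.\<close>
lemma indep_prob_tendsto_exp: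
  assumes "(\<lambda>n. real (t n) * sqrt (p n / 2)) \<longlonglongrightarrow> A"
  shows "(\<lambda>n. P n (t n)) \<longlonglongrightarrow> exp (- A\<^sup>2)"
proof -
  define u where "u n = real (t n) * sqrt (p n / 2)" for n
  define d where "d n = u n * sqrt (2 * p n)" for n
  have u: "(\<lambda>n. u n) \<longlonglongrightarrow> A"
    unfolding u_def by (rule assms)
  have d: "(\<lambda>n. d n) \<longlonglongrightarrow> 0"
    unfolding d_def using tendsto_mult[OF u sqrt_p_tendsto[of 2]] by simp
  have d_eq: "real (t n) * p n = d n" for n
    using p_nonneg[of n] by (simp add: d_def u_def real_sqrt_divide real_sqrt_mult)
  have u_eq: "p n * (real (t n))\<^sup>2 / 2 = (u n)\<^sup>2" for n
    using p_nonneg[of n] by (simp add: u_def power_mult_distrib)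
  have u_eq': "p n * (real (t n))\<^sup>2 = 2 * (u n)\<^sup>2" for n
    using u_eq[of n] by simp
  have "\<forall>\<^sub>F n in sequentially. d n < 1 / 4"
    using d by (rule order_tendstoD) simp
  then have ev: "\<forall>\<^sub>F n in sequentially. U n \<noteq> {} \<and> M n > 0 \<and> real (t n) * p n \<le> 1 / 4"
    using M_pos U_nonempty by eventually_elim (simp add: d_eq)
  show ?thesis
  proof (rule tendsto_sandwich)
    show "\<forall>\<^sub>F n in sequentially. exp (- (u n)\<^sup>2 * (1 + 6 * d n)) \<le> P n (t n)"
      using ev
    proof eventually_elim
      case (elim n)
      then show ?case
        using regular_graph.indep_prob_ge[OF regular, of n "t n"] by (simp add: density_eq_p d_eq u_eq)
    qed
    show "\<forall>\<^sub>F n in sequentially. P n (t n) \<le> exp (- (u n)\<^sup>2 + d n / 2) + 2 * (u n)\<^sup>2 * d n"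
      using ev
    proof eventually_elim
      case (elim n)
      then show ?case
        using regular_graph.indep_prob_le[OF regular, of n "t n"]
        by (simp add: density_eq_p d_eq u_eq u_eq')
    qed
    have "(\<lambda>n. exp (- (u n)\<^sup>2 * (1 + 6 * d n))) \<longlonglongrightarrow> exp (- A\<^sup>2 * (1 + 6 * 0))"
      by (intro tendsto_intros u d)
    then show "(\<lambda>n. exp (- (u n)\<^sup>2 * (1 + 6 * d n))) \<longlonglongrightarrow> exp (- A\<^sup>2)"
      by simp
    have "(\<lambda>n. exp (- (u n)\<^sup>2 + d n / 2) + 2 * (u n)\<^sup>2 * d n) \<longlonglongrightarrow>
        exp (- A\<^sup>2 + 0 / 2) + 2 * A\<^sup>2 * 0"
      by (intro tendsto_intros u d) simp
    then show "(\<lambda>n. exp (- (u n)\<^sup>2 + d n / 2) + 2 * (u n)\<^sup>2 * d n) \<longlonglongrightarrow> exp (- A\<^sup>2)"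
      by simp
  qed
qed

text \<open>The finite bounds need \<open>t * p \<le> 1/4\<close>, which may fail here. Instead, shrink the random set: by monotonicity
  its probability is at most that for a size \<open>t'\<close> with \<open>t' * sqrt (p / 2)\<close> tending to \<open>A\<close>, hence at most
  about \<open>exp (- A^2)\<close>, and \<open>A\<close> is arbitrary.\<close>
lemma indep_prob_tendsto_0:
  assumes "filterlim (\<lambda>n. real (t n) * sqrt (p n / 2)) at_top sequentially"
  shows "(\<lambda>n. P n (t n)) \<longlonglongrightarrow> 0"
proof (rule order_tendstoI)
  fix a :: real
  assume "a < 0"
  then show "\<forall>\<^sub>F n in sequentially. a < P n (t n)"
    using regular_graph.indep_prob_nonneg[OF regular]
    by (intro always_eventually allI) (rule less_le_trans)
next
  fix e :: real
  assume e: "0 < e"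
  have "((\<lambda>x::real. exp (- x\<^sup>2)) \<longlongrightarrow> 0) at_top"
    by real_asymp
  then have "\<forall>\<^sub>F x::real in at_top. exp (- x\<^sup>2) < e \<and> 0 \<le> x"
    using e by (intro eventually_conj order_tendstoD eventually_ge_at_top)
  from eventually_happens[OF this] obtain A :: real where A: "exp (- A\<^sup>2) < e" "0 \<le> A"
    by auto
  define s where "s n = sqrt (p n / 2)" for n
  define t' where "t' n = nat \<lfloor>A / s n\<rfloor>" for n
  have s0: "(\<lambda>n. s n) \<longlonglongrightarrow> 0"
    using sqrt_p_tendsto[of "1 / 2"] by (simp add: s_def)
  have s_pos: "\<forall>\<^sub>F n in sequentially. s n > 0"
    using p_pos by eventually_elim (simp add: s_def)
  have "(\<lambda>n. real (t' n) * s n) \<longlonglongrightarrow> A"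
  proof (rule tendsto_sandwich)
    show "\<forall>\<^sub>F n in sequentially. A - s n \<le> real (t' n) * s n"
      using s_pos
    proof eventually_elim
      case (elim n)
      have "A / s n - 1 \<le> real (t' n)"
        unfolding t'_def by linarith
      from mult_right_mono[OF this less_imp_le[OF elim]] show ?case
        using elim by (simp add: left_diff_distrib)
    qed
    show "\<forall>\<^sub>F n in sequentially. real (t' n) * s n \<le> A"
      using s_pos
    proof eventually_elim
      case (elim n)
      have "real (t' n) \<le> A / s n"
        unfolding t'_def using elim A by simp
      then show ?case
        using elim by (simp add: pos_le_divide_eq)
    qed
    show "(\<lambda>n. A - s n) \<longlonglongrightarrow> A"
      using tendsto_diff[OF tendsto_const s0] by simp
  qed simp
  then have "(\<lambda>n. P n (t' n)) \<longlonglongrightarrow> exp (- A\<^sup>2)"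
    unfolding s_def by (rule indep_prob_tendsto_exp)
  then have "\<forall>\<^sub>F n in sequentially. P n (t' n) < e"
    using A(1) by (rule order_tendstoD)
  moreover have "\<forall>\<^sub>F n in sequentially. A \<le> real (t n) * s n"
    using assms unfolding s_def filterlim_at_top by blast
  ultimately show "\<forall>\<^sub>F n in sequentially. P n (t n) < e"
    using s_pos
  proof eventually_elim
    case (elim n)
    have "A / s n \<le> real (t n)"
      using elim by (simp add: pos_divide_le_eq)
    then have "t' n \<le> t n"
      unfolding t'_def by linarith
    then have "P n (t n) \<le> P n (t' n)"
      by (rule regular_graph.indep_prob_antimono[OF regular])
    then show ?case
      using elim by simp
  qed
qed

text \<open>Only the asymptotic behaviour of the threshold matters: any \<open>s\<close> asymptotic to \<open>sqrt (2 / p)\<close>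
  serves. This is what lets one argument treat both forms of the threshold.\<close>
lemma threshold:
  assumes s: "(\<lambda>n. s n * sqrt (p n / 2)) \<longlonglongrightarrow> 1"
  shows "much_less (\<lambda>n. real (t n)) s \<Longrightarrow> (\<lambda>n. P n (t n)) \<longlonglongrightarrow> 1"
    and "much_less s (\<lambda>n. real (t n)) \<Longrightarrow> (\<lambda>n. P n (t n)) \<longlonglongrightarrow> 0"
    and "asymp_multiple (\<lambda>n. real (t n)) A s \<Longrightarrow> (\<lambda>n. P n (t n)) \<longlonglongrightarrow> exp (- A\<^sup>2)"
proof -
  have "\<forall>\<^sub>F n in sequentially. 0 < s n * sqrt (p n / 2)"
    using s by (rule order_tendstoD) simp
  then have s_pos: "\<forall>\<^sub>F n in sequentially. 0 < s n"
  proof eventually_elim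
    case (elim n)
    then show ?case
      using p_nonneg[of n] by (auto simp: zero_less_mult_iff)
  qed
  show "(\<lambda>n. P n (t n)) \<longlonglongrightarrow> 1" if less: "much_less (\<lambda>n. real (t n)) s"
  proof -
    have "(\<lambda>n. real (t n) / s n * (s n * sqrt (p n / 2))) \<longlonglongrightarrow> 0 * 1"
      using less s by (intro tendsto_mult) (auto simp: much_less_def)
    moreover have "\<forall>\<^sub>F n in sequentially.
        real (t n) / s n * (s n * sqrt (p n / 2)) = real (t n) * sqrt (p n / 2)"
      using s_pos by eventually_elim simp
    ultimately have "(\<lambda>n. real (t n) * sqrt (p n / 2)) \<longlonglongrightarrow> 0 * 1"
      by (rule Lim_transform_eventually)
    then show ?thesis
      using indep_prob_tendsto_exp[of t 0] by simp
  qed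
  show "(\<lambda>n. P n (t n)) \<longlonglongrightarrow> 0" if less: "much_less s (\<lambda>n. real (t n))"
  proof -
    have t_pos: "\<forall>\<^sub>F n in sequentially. 0 < real (t n)"
      using less by (simp add: much_less_def)
    have "\<forall>\<^sub>F n in sequentially. 0 < s n / real (t n)"
      using s_pos t_pos by eventually_elim simp
    then have "filterlim (\<lambda>n. inverse (s n / real (t n))) at_top sequentially"
      using less by (intro filterlim_inverse_at_top) (auto simp: much_less_def)
    then have "filterlim (\<lambda>n. s n * sqrt (p n / 2) * inverse (s n / real (t n))) at_top sequentially"
      by (rule filterlim_tendsto_pos_mult_at_top[OF s zero_less_one])
    moreover have "\<forall>\<^sub>F n in sequentially.
        s n * sqrt (p n / 2) * inverse (s n / real (t n)) = real (t n) * sqrt (p n / 2)"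
      using s_pos by eventually_elim simp
    ultimately have "filterlim (\<lambda>n. real (t n) * sqrt (p n / 2)) at_top sequentially"
      by (rule iffD1[OF filterlim_cong[OF refl refl], rotated])
    then show ?thesis
      by (rule indep_prob_tendsto_0)
  qed
  show "(\<lambda>n. P n (t n)) \<longlonglongrightarrow> exp (- A\<^sup>2)" if multiple: "asymp_multiple (\<lambda>n. real (t n)) A s"
  proof -
    obtain \<epsilon> where \<epsilon>: "\<epsilon> \<longlonglongrightarrow> 0"
      and t: "\<forall>\<^sub>F n in sequentially. real (t n) = (A + \<epsilon> n) * s n"
      using multiple unfolding asymp_multiple_def by blast
    have "(\<lambda>n. (A + \<epsilon> n) * (s n * sqrt (p n / 2))) \<longlonglongrightarrow> (A + 0) * 1"
      by (intro tendsto_intros \<epsilon> s)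
    moreover have "\<forall>\<^sub>F n in sequentially.
        (A + \<epsilon> n) * (s n * sqrt (p n / 2)) = real (t n) * sqrt (p n / 2)"
      using t by eventually_elim simp
    ultimately have "(\<lambda>n. real (t n) * sqrt (p n / 2)) \<longlonglongrightarrow> (A + 0) * 1"
      by (rule Lim_transform_eventually)
    then show ?thesis
      by (intro indep_prob_tendsto_exp) simp
  qed
qed

end

section \<open>The Kneser graph\<close>

definition k_subsets :: "'a set \<Rightarrow> nat \<Rightarrow> 'a set set" where
  "k_subsets V k = {S. S \<subseteq> V \<and> card S = k}"

definition disjoint_k_subsets :: "'a set \<Rightarrow> nat \<Rightarrow> 'a set \<Rightarrow> 'a set set" where
  "disjoint_k_subsets V k S = {T \<in> k_subsets V k. S \<inter> T = {}}"

lemma Kneser_regular_graph: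
  assumes V: "finite V" and k: "k > 0"
  shows "regular_graph (k_subsets V k) (disjoint_k_subsets V k) ((card V - k) choose k)"
proof
  show "finite (k_subsets V k)"
    by (rule finite_subset[of _ "Pow V"]) (use V in \<open>auto simp: k_subsets_def\<close>)
next
  fix S assume "S \<in> k_subsets V k"
  then have S: "S \<subseteq> V" "card S = k" "finite S"
    using V finite_subset by (auto simp: k_subsets_def)
  have "disjoint_k_subsets V k S = {T. T \<subseteq> V - S \<and> card T = k}"
    by (auto simp: disjoint_k_subsets_def k_subsets_def)
  then show "card (disjoint_k_subsets V k S) = (card V - k) choose k"
    using n_subsets[of "V - S" k] V S by (simp add: card_Diff_subset)
  show "S \<notin> disjoint_k_subsets V k S"
    using S k by (auto simp: disjoint_k_subsets_def)
qed (auto simp: disjoint_k_subsets_def k_subsets_def)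

text \<open>Since \<open>k > 0\<close>, disjoint \<open>k\<close>-sets are distinct, so the counted pairs are exactly the edges of the
  Kneser graph inside \<open>F\<close>.\<close>
lemma num_disjoint_pairs_eq_0_iff:
  assumes "finite V" "F \<subseteq> k_subsets V k" "k > 0"
  shows "num_disjoint_pairs F = 0 \<longleftrightarrow> (\<forall>S\<in>F. disjoint_k_subsets V k S \<inter> F = {})"
proof -
  let ?D = "{{S, T} | S T. S \<in> F \<and> T \<in> F \<and> S \<noteq> T \<and> S \<inter> T = {}}"
  have "finite (k_subsets V k)"
    by (rule finite_subset[of _ "Pow V"]) (use assms in \<open>auto simp: k_subsets_def\<close>)
  then have "finite F"
    using assms finite_subset by blast
  then have "finite ?D"
    by (intro finite_subset[of ?D "Pow F"]) auto
  then have "num_disjoint_pairs F = 0 \<longleftrightarrow> ?D = {}"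
    by (simp add: num_disjoint_pairs_def)
  also have "\<dots> \<longleftrightarrow> (\<forall>S\<in>F. \<forall>T\<in>F. S \<inter> T = {} \<longrightarrow> S = T)"
    by blast
  also have "\<dots> \<longleftrightarrow> (\<forall>S\<in>F. \<forall>T\<in>F. S \<inter> T \<noteq> {})"
  proof -
    have "S \<noteq> {}" if "S \<in> F" for S
      using that assms(2,3) by (auto simp: k_subsets_def)
    then show ?thesis by fastforce
  qed
  also have "\<dots> \<longleftrightarrow> (\<forall>S\<in>F. disjoint_k_subsets V k S \<inter> F = {})"
    using assms(2) by (auto simp: disjoint_k_subsets_def)
  finally show ?thesis .
qed

lemma prob_intersecting_eq_indep_prob:
  assumes V: "finite V" and k: "k > 0" and t: "t \<le> card V choose k"
  shows "measure_pmf.prob (random_family V k t) {F. num_disjoint_pairs F = 0} =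
           regular_graph.indep_prob (k_subsets V k) (disjoint_k_subsets V k) t"
proof -
  interpret regular_graph "k_subsets V k" "disjoint_k_subsets V k" "(card V - k) choose k"
    by (rule Kneser_regular_graph[OF V k])
  have families: "uniform_families V k t = {F. F \<subseteq> k_subsets V k \<and> card F = t}"
    by (simp add: uniform_families_def k_subsets_def)
  have "uniform_families V k t \<inter> {F. num_disjoint_pairs F = 0} = indep_sets t"
    unfolding families indep_sets_def using num_disjoint_pairs_eq_0_iff[OF V _ k] by auto
  moreover have "card (uniform_families V k t) = card (k_subsets V k) choose t"
    unfolding families by (rule n_subsets[OF fin])
  ultimately show ?thesis
    unfolding random_family_def indep_prob_def
    by (simp add: measure_pmf_of_set finite_uniform_families uniform_families_nonempty V t)
qed

section \<open>The ratio of the binomial coefficients\<close>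

text \<open>The quotient is \<open>1 / (1 - x)\<close> with \<open>x = k / (n - i)\<close>. As \<open>x\<close> exceeds \<open>k / n\<close> by at most
  \<open>4/3 * (k / n)^2\<close>, and \<open>- ln (1 - x)\<close> exceeds \<open>x\<close> by at most \<open>2 * x^2 \<le> 32/9 * (k / n)^2\<close>,
  the constant \<open>5\<close> suffices.\<close>
lemma binomial_factor_bounds:
  fixes n k i :: real
  assumes "0 \<le> i" "i < k" "4 * k \<le> n"
  shows "exp (k / n) \<le> (n - i) / (n - k - i)"
    and "(n - i) / (n - k - i) \<le> exp (k / n + 5 * k\<^sup>2 / n\<^sup>2)"
proof -
  define x where "x = k / (n - i)"
  have ni: "0 < n" "0 < k" "3 / 4 * n \<le> n - i"
    using assms by auto
  have x1: "k / n \<le> x"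
    unfolding x_def using assms ni by (intro divide_left_mono) auto
  have x_le: "x \<le> 4 / 3 * (k / n)"
  proof -
    have "x \<le> k / (3 / 4 * n)"
      unfolding x_def using assms ni by (intro divide_left_mono) auto
    then show ?thesis by simp
  qed
  have kn: "k / n \<le> 1 / 4" "0 < k / n"
    using assms ni by (auto simp: field_simps)
  have x0: "0 \<le> x" "x \<le> 1 / 2"
    using x1 x_le kn by linarith+
  have eq: "(n - i) / (n - k - i) = 1 / (1 - x)"
    using ni assms by (simp add: x_def field_simps)
  have "exp (k / n) \<le> exp x"
    using x1 by simp
  also have "1 - x \<le> exp (- x)"
    using exp_ge_add_one_self[of "- x"] by simp
  then have "exp x \<le> 1 / (1 - x)"
    using x0 by (simp add: exp_minus field_simps)
  finally show "exp (k / n) \<le> (n - i) / (n - k - i)"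
    by (simp add: eq)
  have "x - k / n = (k / n) * (i / (n - i))"
    using ni by (simp add: x_def field_simps)
  also have "\<dots> \<le> (k / n) * x"
    unfolding x_def using assms ni kn by (intro mult_left_mono divide_right_mono) auto
  also have "\<dots> \<le> (k / n) * (4 / 3 * (k / n))"
    using x_le kn by (intro mult_left_mono) auto
  finally have 1: "x \<le> k / n + 4 / 3 * (k / n)\<^sup>2"
    by (simp add: power2_eq_square)
  have "x\<^sup>2 \<le> (4 / 3 * (k / n))\<^sup>2"
    using x0 x_le by (intro power_mono) auto
  then have 2: "2 * x\<^sup>2 \<le> 32 / 9 * (k / n)\<^sup>2"
    by (simp add: power_mult_distrib power2_eq_square)
  have "- (k / n + 5 * (k / n)\<^sup>2) \<le> - x - 2 * x\<^sup>2"
    using 1 2 zero_le_power2[of "k / n"] by linarith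
  also have "\<dots> \<le> ln (1 - x)"
    by (rule ln_one_minus_pos_lower_bound[OF x0])
  finally have "exp (- (k / n + 5 * (k / n)\<^sup>2)) \<le> 1 - x"
    using x0 by (simp add: ln_ge_iff)
  then have "1 / (1 - x) \<le> 1 / exp (- (k / n + 5 * (k / n)\<^sup>2))"
    using x0 by (intro divide_left_mono) auto
  then show "(n - i) / (n - k - i) \<le> exp (k / n + 5 * k\<^sup>2 / n\<^sup>2)"
    unfolding eq exp_minus divide_inverse[of 1 "inverse _"] inverse_inverse_eq
    by (simp add: power_divide)
qed

text \<open>The product of the \<open>k\<close> factor bounds. The lower bound shows that the Kneser graph is sparse once
  \<open>k^2 / n\<close> tends to infinity; the two bounds together determine the ratio asymptotically when
  \<open>k^3 / n^2\<close> tends to \<open>0\<close>.\<close>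
lemma binomial_ratio_bounds:
  assumes "4 * k \<le> n"
  shows "exp ((real k)\<^sup>2 / real n) \<le> real (n choose k) / real ((n - k) choose k)"
    and "real (n choose k) / real ((n - k) choose k) \<le> exp ((real k)\<^sup>2 / real n + 5 * real k ^ 3 / (real n)\<^sup>2)"
proof -
  have eq: "real (n choose k) / real ((n - k) choose k) =
      (\<Prod>i<k. (real n - real i) / (real n - real k - real i))"
  proof -
    have "real (n choose k) / real ((n - k) choose k) =
      (\<Prod>i<k. (real (n - i) / real (k - i)) / (real (n - k - i) / real (k - i)))"
      using assms by (simp add: binomial_altdef_of_nat prod_dividef atLeast0LessThan)
    also have "\<dots> = (\<Prod>i<k. (real n - real i) / (real n - real k - real i))"
      by (rule prod.cong) (use assms in \<open>auto simp: of_nat_diff\<close>)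
    finally show ?thesis .
  qed
  have "exp ((real k)\<^sup>2 / real n) = (\<Prod>i<k. exp (real k / real n))"
    by (simp add: exp_of_nat_mult [symmetric] power2_eq_square)
  also have "\<dots> \<le> (\<Prod>i<k. (real n - real i) / (real n - real k - real i))"
    by (rule prod_mono) (use assms binomial_factor_bounds(1) in auto)
  finally show "exp ((real k)\<^sup>2 / real n) \<le> real (n choose k) / real ((n - k) choose k)"
    by (simp add: eq)
  have "(\<Prod>i<k. (real n - real i) / (real n - real k - real i)) \<le>
      (\<Prod>i<k. exp (real k / real n + 5 * (real k)\<^sup>2 / (real n)\<^sup>2))"
    by (rule prod_mono) (use assms binomial_factor_bounds(2) in auto)
  also have "\<dots> = exp ((real k)\<^sup>2 / real n + 5 * real k ^ 3 / (real n)\<^sup>2)"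
    by (simp add: exp_of_nat_mult [symmetric] power2_eq_square power3_eq_cube algebra_simps)
  finally show "real (n choose k) / real ((n - k) choose k) \<le> exp ((real k)\<^sup>2 / real n + 5 * real k ^ 3 / (real n)\<^sup>2)"
    by (simp add: eq)
qed

section \<open>The threshold for the EKR property\<close>

theorem theorem1:
  fixes V :: "nat \<Rightarrow> 'a set" and k t :: "nat \<Rightarrow> nat"
  assumes "\<And>n. finite (V n)" and "\<And>n. card (V n) = n"
    and "\<And>n. k n > 0"
    and "filterlim (\<lambda>n. real (k n) / sqrt (real n)) at_top sequentially"
    and "(\<lambda>n. real (k n) / real n) \<longlonglongrightarrow> 0"
    and "\<And>n. t n \<le> n choose k n"
  shows
    "let P = (\<lambda>n. measure_pmf.prob (random_family (V n) (k n) (t n))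
                    {F. num_disjoint_pairs F = 0});
         T = (\<lambda>n. real (t n));
         s = (\<lambda>n. t0 n (k n));
         s' = (\<lambda>n. sqrt 2 * exp ((real (k n))\<^sup>2 / (2 * real n)))
     in (much_less T s \<longrightarrow> P \<longlonglongrightarrow> 1) \<and>
        (much_less s T \<longrightarrow> P \<longlonglongrightarrow> 0) \<and>
        (\<forall>A>0. asymp_multiple T A s \<longrightarrow> P \<longlonglongrightarrow> exp (- (A\<^sup>2))) \<and>
        ((\<lambda>n. real (k n)) \<in> o(\<lambda>n. real n powr (2 / 3)) \<longrightarrow>
           (much_less T s' \<longrightarrow> P \<longlonglongrightarrow> 1) \<and>
           (much_less s' T \<longrightarrow> P \<longlonglongrightarrow> 0) \<and>
           (\<forall>A>0. asymp_multiple T A s' \<longrightarrow> P \<longlonglongrightarrow> exp (- (A\<^sup>2))))"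
proof -
  have card_U: "card (k_subsets (V n) (k n)) = n choose k n" for n
    using n_subsets[OF assms(1)[of n], of "k n"] by (simp add: assms(2) k_subsets_def)
  have "\<forall>\<^sub>F n in sequentially. real (k n) / real n < 1 / 4"
    using assms(5) by (rule order_tendstoD) simp
  then have large: "\<forall>\<^sub>F n in sequentially. n > 0 \<and> 4 * k n \<le> n"
    using eventually_gt_at_top[of 0]
  proof eventually_elim
    case (elim n)
    then have "4 * real (k n) < real n" by (simp add: field_simps)
    then show ?case using elim by linarith
  qed
  have "filterlim (\<lambda>n. (real (k n) / sqrt (real n)) ^ 2) at_top sequentially"
    by (rule filterlim_pow_at_top[OF _ assms(4)]) simp
  then have "filterlim (\<lambda>n. (real (k n))\<^sup>2 / real n) at_top sequentially"
    by (simp add: power_divide)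
  then have exp_0: "(\<lambda>n. exp (- ((real (k n))\<^sup>2 / real n))) \<longlonglongrightarrow> 0"
    by (intro filterlim_compose[OF exp_at_bot] filterlim_compose[OF filterlim_uminus_at_bot_at_top])
  have inverse_ratio: "real ((n - k n) choose k n) / real (n choose k n) =
      inverse (real (n choose k n) / real ((n - k n) choose k n))" for n
    by simp
  have density_le: "\<forall>\<^sub>F n in sequentially.
      real ((n - k n) choose k n) / real (n choose k n) \<le> exp (- ((real (k n))\<^sup>2 / real n))"
    using large
  proof eventually_elim
    case (elim n)
    then show ?case
      using le_imp_inverse_le[OF binomial_ratio_bounds(1)[of "k n" n]]
      by (simp only: inverse_ratio exp_minus exp_gt_zero simp_thms)
  qed
  interpret sparse_regular_graphs "\<lambda>n. k_subsets (V n) (k n)"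
    "\<lambda>n. disjoint_k_subsets (V n) (k n)" "\<lambda>n. (n - k n) choose k n"
  proof (rule sparse_regular_graphs.intro)
    show "regular_graph (k_subsets (V n) (k n)) (disjoint_k_subsets (V n) (k n)) ((n - k n) choose k n)" for n
      using Kneser_regular_graph[OF assms(1) assms(3), of n n] by (simp add: assms(2))
    show "\<forall>\<^sub>F n in sequentially. 0 < (n - k n) choose k n"
      using large by eventually_elim (auto intro: zero_less_binomial)
    show "\<forall>\<^sub>F n in sequentially. k_subsets (V n) (k n) \<noteq> {}"
      using large
    proof eventually_elim
      case (elim n)
      then have "card (k_subsets (V n) (k n)) > 0" by (simp add: card_U)
      then show ?case by force
    qed
    show "(\<lambda>n. real ((n - k n) choose k n) / real (card (k_subsets (V n) (k n)))) \<longlonglongrightarrow> 0"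
      unfolding card_U
      by (rule tendsto_sandwich[OF _ density_le tendsto_const exp_0]) simp
  qed
  have p: "p n = real ((n - k n) choose k n) / real (n choose k n)" for n
    by (simp add: p_def card_U)
  have prob: "measure_pmf.prob (random_family (V n) (k n) (t n)) {F. num_disjoint_pairs F = 0} = P n (t n)" for n
    by (rule prob_intersecting_eq_indep_prob) (simp_all add: assms)
  have "\<forall>\<^sub>F n in sequentially. 1 = t0 n (k n) * sqrt (p n / 2)"
    using p_pos
  proof eventually_elim
    case (elim n)
    have "t0 n (k n) = sqrt (2 / p n)"
      by (simp add: t0_def p)
    then show ?case
      using elim by (simp add: real_sqrt_mult [symmetric])
  qed
  then have t0_lim: "(\<lambda>n. t0 n (k n) * sqrt (p n / 2)) \<longlonglongrightarrow> 1"
    by (rule Lim_transform_eventually[OF tendsto_const])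
  have exp_lim: "(\<lambda>n. sqrt 2 * exp ((real (k n))\<^sup>2 / (2 * real n)) * sqrt (p n / 2)) \<longlonglongrightarrow> 1"
    if small: "(\<lambda>n. real (k n)) \<in> o(\<lambda>n. real n powr (2 / 3))"
  proof -
    define e where "e n = (real (k n))\<^sup>2 / real n" for n
    define r where "r n = real (k n) ^ 3 / (real n)\<^sup>2" for n
    \<comment> \<open>\<open>k = o(n^(2/3))\<close> makes the error exponent \<open>k^3 / n^2\<close> vanish\<close>
    have "(\<lambda>n. (real (k n) / real n powr (2 / 3)) ^ 3) \<longlonglongrightarrow> 0 ^ 3"
      by (intro tendsto_power smalloD_tendsto[OF small])
    moreover have "\<forall>\<^sub>F n in sequentially. (real (k n) / real n powr (2 / 3)) ^ 3 = r n"
      using large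
    proof eventually_elim
      case (elim n)
      then have "(real n powr (2 / 3)) ^ 3 = (real n)\<^sup>2"
        by (simp add: powr_power)
      then show ?case by (simp add: r_def power_divide)
    qed
    ultimately have "(\<lambda>n. r n) \<longlonglongrightarrow> 0 ^ 3"
      by (rule Lim_transform_eventually)
    then have r: "(\<lambda>n. r n) \<longlonglongrightarrow> 0"
      by simp
    have root: "sqrt 2 * exp ((real (k n))\<^sup>2 / (2 * real n)) * sqrt (p n / 2) = sqrt (exp (e n) * p n)" for n
    proof -
      have "exp ((real (k n))\<^sup>2 / (2 * real n)) = sqrt (exp (e n))"
        by (rule real_sqrt_unique [symmetric])
           (simp_all add: e_def exp_of_nat_mult [symmetric] field_simps)
      then show ?thesis by (simp add: real_sqrt_mult real_sqrt_divide)
    qed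
    have "(\<lambda>n. exp (e n) * p n) \<longlonglongrightarrow> 1"
    proof (rule tendsto_sandwich)
      show "\<forall>\<^sub>F n in sequentially. exp (- (5 * r n)) \<le> exp (e n) * p n"
        using large p_pos
      proof eventually_elim
        case (elim n)
        have "inverse (p n) \<le> exp (e n + 5 * r n)"
          using binomial_ratio_bounds(2)[of "k n" n] elim by (simp add: p e_def r_def)
        then have "1 \<le> exp (e n + 5 * r n) * p n"
          using elim by (simp add: field_simps)
        then show ?case
          by (simp add: exp_add exp_minus field_simps)
      qed
      show "\<forall>\<^sub>F n in sequentially. exp (e n) * p n \<le> 1"
        using density_le
      proof eventually_elim
        case (elim n)
        then have "p n \<le> exp (- e n)" by (simp add: p e_def)
        then show ?case
          by (simp add: exp_minus field_simps)
      qed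
      have "(\<lambda>n. exp (- (5 * r n))) \<longlonglongrightarrow> exp (- (5 * 0))"
        by (intro tendsto_intros r)
      then show "(\<lambda>n. exp (- (5 * r n))) \<longlonglongrightarrow> 1"
        by simp
    qed simp
    then have "(\<lambda>n. sqrt (exp (e n) * p n)) \<longlonglongrightarrow> sqrt 1"
      by (rule tendsto_real_sqrt)
    then show ?thesis by (simp add: root)
  qed
  show ?thesis
    unfolding Let_def prob
    using threshold[OF t0_lim] threshold[OF exp_lim] by blast
qed

end
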